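(* Let $E,F$ be locally convex spaces, $U$ an open neighborhood of $0$ in $E$, and $f:U\to F$ a function. If $f$ is Lipschitz, then $f$ is a finite function.
   Context: We work in a sufficiently saturated nonstandard extension; $A^*$ is the nonstandard extension of $A$, and the extension of a function is denoted by the same symbol. A locally convex space is a real Hausdorff topological vector space with a base of convex neighborhoods of $0$. $f:U\to F$ is Lipschitz if for every continuous seminorm $q$ on $F$ there is a continuous seminorm $p$ on $E$ with $q(f(x_1)-f(x_2))\le p(x_1-x_2)$ for all $x_1,x_2\in U$. $E_f=\{x\in E^* : p(x)$ is a finite hyperreal for all continuous seminorms $p$ on $E\}$, and similarly $F_f$. $f$ is a finite function if $f(U^*\cap E_f)\subseteq F_f$. *)

theory Defs
  imports "HOL-Analysis.Analysis"
begin

section \<open>Locally convex spaces\<close>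

text \<open>
  The constant \<open>convex\<close> cannot occur in a class specification, so its definition is unfolded
  there; \<open>lcs_convex_neighborhood_base\<close> restates the axiom.
\<close>

class locally_convex_space = real_vector + topological_ab_group_add + t2_space +
  assumes tendsto_scaleR_Pair:
    "LIM x (nhds c \<times>\<^sub>F nhds a). fst x *\<^sub>R snd x :> nhds (c *\<^sub>R a)"
    and convex_neighborhood_base:
    "open V \<Longrightarrow> 0 \<in> V \<Longrightarrow>
      \<exists>W C. open W \<and> 0 \<in> W \<and> W \<subseteq> C \<and> C \<subseteq> V \<and>
        (\<forall>x\<in>C. \<forall>y\<in>C. \<forall>u\<ge>0. \<forall>v\<ge>0. u + v = 1 \<longrightarrow> u *\<^sub>R x + v *\<^sub>R y \<in> C)"

lemma lcs_convex_neighborhood_base: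
  fixes V :: "'e::locally_convex_space set"
  assumes "open V" and "0 \<in> V"
  shows "\<exists>W C. open W \<and> 0 \<in> W \<and> W \<subseteq> C \<and> C \<subseteq> V \<and> convex C"
  using convex_neighborhood_base[OF assms] unfolding convex_def .

instance real_normed_vector < locally_convex_space
proof
  fix c :: real and a :: 'a
  show "LIM x (nhds c \<times>\<^sub>F nhds a). fst x *\<^sub>R snd x :> nhds (c *\<^sub>R a)"
    using tendsto_scaleR[OF tendsto_fst[OF filterlim_ident] tendsto_snd[OF filterlim_ident], of "(c, a)"]
    by (simp add: nhds_prod)
next
  fix V :: "'a set"
  assume "open V" and "0 \<in> V"
  then obtain e where e: "e > 0" "ball 0 e \<subseteq> V"
    using open_contains_ball by blast
  show "\<exists>W C. open W \<and> 0 \<in> W \<and> W \<subseteq> C \<and> C \<subseteq> V \<and>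
        (\<forall>x\<in>C. \<forall>y\<in>C. \<forall>u\<ge>0. \<forall>v\<ge>0. u + v = 1 \<longrightarrow> u *\<^sub>R x + v *\<^sub>R y \<in> C)"
    using e convex_ball[of "0::'a" e, unfolded convex_def] open_ball[of "0::'a" e]
    by (intro exI[of _ "ball 0 e"]) auto
qed

definition continuous_seminorm :: "('e::locally_convex_space \<Rightarrow> real) \<Rightarrow> bool" where
  "continuous_seminorm p \<longleftrightarrow>
     (\<forall>x. 0 \<le> p x) \<and>
     (\<forall>c x. p (c *\<^sub>R x) = \<bar>c\<bar> * p x) \<and>
     (\<forall>x y. p (x + y) \<le> p x + p y) \<and>
     continuous_on UNIV p"

definition lipschitz_lcs ::
  "'e::locally_convex_space set \<Rightarrow> ('e \<Rightarrow> 'f::locally_convex_space) \<Rightarrow> bool" where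
  "lipschitz_lcs U f \<longleftrightarrow>
     (\<forall>q. continuous_seminorm q \<longrightarrow>
        (\<exists>p. continuous_seminorm p \<and> (\<forall>x1\<in>U. \<forall>x2\<in>U. q (f x1 - f x2) \<le> p (x1 - x2))))"

section \<open>Nonstandard extensions\<close>

text \<open>
  The axioms are those of C. W. Henson, ``Foundations of nonstandard analysis: a gentle
  introduction'' (1997).  The standard universe is a type \<open>'u\<close>, its extension is a type
  \<open>'s\<close>, and the \<open>n\<close>-fold Cartesian power of either is rendered as the set of lists of
  length \<open>n\<close>.  The extension assigns to each standard relation (of any finite arity) a
  relation of the same arity over \<open>'s\<close>, compatibly with Boolean operations, basic diagonals,
  Cartesian products and projections; these axioms are equivalent to the transfer principle
  for first-order formulas in the language of all relations over the universe.
\<close>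

definition tuples :: "nat \<Rightarrow> 'a list set" where
  "tuples n = {xs. length xs = n}"

locale nonstandard_extension =
  fixes star :: "'u list set \<Rightarrow> 's list set"
  assumes star_arity: "A \<subseteq> tuples n \<Longrightarrow> star A \<subseteq> tuples n"
    and star_universe: "star (tuples 1) = tuples 1"
    and star_Int: "A \<subseteq> tuples n \<Longrightarrow> B \<subseteq> tuples n \<Longrightarrow> star (A \<inter> B) = star A \<inter> star B"
    and star_Un: "A \<subseteq> tuples n \<Longrightarrow> B \<subseteq> tuples n \<Longrightarrow> star (A \<union> B) = star A \<union> star B"
    and star_Diff: "A \<subseteq> tuples n \<Longrightarrow> B \<subseteq> tuples n \<Longrightarrow> star (A - B) = star A - star B"
    and star_diagonal: "i < j \<Longrightarrow> j < n \<Longrightarrow>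
      star {xs \<in> tuples n. xs ! i = xs ! j} = {xs \<in> tuples n. xs ! i = xs ! j}"
    and star_product: "A \<subseteq> tuples m \<Longrightarrow> B \<subseteq> tuples n \<Longrightarrow>
      star {xs @ ys | xs ys. xs \<in> A \<and> ys \<in> B} = {xs @ ys | xs ys. xs \<in> star A \<and> ys \<in> star B}"
    and star_projection: "A \<subseteq> tuples (Suc n) \<Longrightarrow> star (butlast ` A) = butlast ` star A"

text \<open>
  A subset of the extended universe is internal if it is a section, with parameters, of the
  extension of a standard relation.  If the universe contains power sets, applying this to the
  membership relation gives the usual notion.
\<close>

definition internal :: "('u list set \<Rightarrow> 's list set) \<Rightarrow> 's set \<Rightarrow> bool" where
  "internal star B \<longleftrightarrow>
     (\<exists>n A b. A \<subseteq> tuples (Suc n) \<and> b \<in> tuples n \<and> B = {s. s # b \<in> star A})"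

definition saturated :: "('u list set \<Rightarrow> 's list set) \<Rightarrow> 'k rel \<Rightarrow> bool" where
  "saturated star \<kappa> \<longleftrightarrow>
     (\<forall>\<A>. (\<forall>B\<in>\<A>. internal star B) \<and> (card_of \<A>, \<kappa>) \<in> ordLess \<and>
          (\<forall>\<F>. finite \<F> \<and> \<F> \<subseteq> \<A> \<longrightarrow> \<Inter>\<F> \<noteq> {})
        \<longrightarrow> \<Inter>\<A> \<noteq> {})"

text \<open>
  A standard type such as \<open>E\<close> is located in the universe by an injection
  \<open>i :: 'a \<Rightarrow> 'u\<close>.  Relative to such injections, the extensions of points, sets, functions
  and binary relations are as follows.  The extension of a function is determined by the
  extension of its graph.
\<close>

definition star_of :: "('u list set \<Rightarrow> 's list set) \<Rightarrow> ('a \<Rightarrow> 'u) \<Rightarrow> 'a \<Rightarrow> 's" where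
  "star_of star i a = (THE s. [s] \<in> star {[i a]})"

definition star_set :: "('u list set \<Rightarrow> 's list set) \<Rightarrow> ('a \<Rightarrow> 'u) \<Rightarrow> 'a set \<Rightarrow> 's set" where
  "star_set star i A = {s. [s] \<in> star {[i a] | a. a \<in> A}}"

definition star_fun ::
  "('u list set \<Rightarrow> 's list set) \<Rightarrow> ('a \<Rightarrow> 'u) \<Rightarrow> ('b \<Rightarrow> 'u) \<Rightarrow> 'a set \<Rightarrow> ('a \<Rightarrow> 'b) \<Rightarrow> 's \<Rightarrow> 's" where
  "star_fun star i j A f s = (THE t. [s, t] \<in> star {[i a, j (f a)] | a. a \<in> A})"

definition star_rel ::
  "('u list set \<Rightarrow> 's list set) \<Rightarrow> ('a \<Rightarrow> 'u) \<Rightarrow> ('b \<Rightarrow> 'u) \<Rightarrow> ('a \<Rightarrow> 'b \<Rightarrow> bool) \<Rightarrow> 's \<Rightarrow> 's \<Rightarrow> bool" where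
  "star_rel star i j R s t \<longleftrightarrow> [s, t] \<in> star {[i a, j b] | a b. R a b}"

definition finite_hyperreal :: "('u list set \<Rightarrow> 's list set) \<Rightarrow> (real \<Rightarrow> 'u) \<Rightarrow> 's \<Rightarrow> bool" where
  "finite_hyperreal star r s \<longleftrightarrow>
     s \<in> star_set star r UNIV \<and>
     (\<exists>n::nat. star_rel star r r (\<le>) (star_fun star r r UNIV abs s) (star_of star r (real n)))"

definition finite_points ::
  "('u list set \<Rightarrow> 's list set) \<Rightarrow> (real \<Rightarrow> 'u) \<Rightarrow> ('e::locally_convex_space \<Rightarrow> 'u) \<Rightarrow> 's set" where
  "finite_points star r i =
     {s \<in> star_set star i UNIV.
        \<forall>p. continuous_seminorm p \<longrightarrow> finite_hyperreal star r (star_fun star i r UNIV p s)}"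

definition finite_function ::
  "('u list set \<Rightarrow> 's list set) \<Rightarrow> (real \<Rightarrow> 'u) \<Rightarrow> ('e::locally_convex_space \<Rightarrow> 'u) \<Rightarrow>
     ('f::locally_convex_space \<Rightarrow> 'u) \<Rightarrow> 'e set \<Rightarrow> ('e \<Rightarrow> 'f) \<Rightarrow> bool" where
  "finite_function star r i j U f \<longleftrightarrow>
     star_fun star i j U f ` (star_set star i U \<inter> finite_points star r i)
       \<subseteq> finite_points star r j"

end

theory Submission
  imports Defs
begin

text \<open>
  Let \<open>q\<close> be a continuous seminorm on \<open>F\<close> and \<open>p\<close> a continuous seminorm on \<open>E\<close> that witnesses the
  Lipschitz condition for \<open>q\<close>.  Comparing with the base point \<open>0 \<in> U\<close> gives
  \<open>q (f x) \<le> p x + q (f 0)\<close> on \<open>U\<close>.  Hence, for every natural number \<open>n\<close> and every natural number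
  \<open>k \<ge> q (f 0)\<close>, the function \<open>f\<close> sends the standard set \<open>{x \<in> U. p x \<le> n}\<close> into
  \<open>{y. q y \<le> n + k}\<close>.

  The nonstandard statement follows by transferring these inclusions, one for each \<open>n\<close>.  The bridge
  is that \<open>p s\<close> is a finite hyperreal exactly if \<open>s\<close> lies in the extension of the standard set
  \<open>{x. \<bar>p x\<bar> \<le> n}\<close> for some standard \<open>n\<close> (\<open>finite_hyperreal_star_fun_iff\<close>), and extended functions
  respect inclusions between standard sets (\<open>star_fun_image\<close>).  The transfer principle enters only for
  unary and binary relations; it is derived from compatibility with intersections,
  products and projections, and the diagonals make the extension of a function single-valued.
\<close>

section \<open>Transfer for unary and binary relations\<close>

lemma butlast_tuples_Suc_0: "butlast ` tuples (Suc 0) = {[]}"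
  by (force simp: tuples_def length_Suc_conv)

context nonstandard_extension
begin

lemma star_mono:
  assumes "A \<subseteq> B" and "B \<subseteq> tuples n"
  shows "star A \<subseteq> star B"
proof -
  have "A \<inter> B = A" and "A \<subseteq> tuples n"
    using assms by auto
  then show ?thesis
    using star_Int[of A n B] assms(2) by auto
qed

lemma star_rel_mono:
  assumes "\<And>a b. R a b \<Longrightarrow> S a b" and "star_rel star i j R s t"
  shows "star_rel star i j S s t"
proof -
  have "star {[i a, j b] | a b. R a b} \<subseteq> star {[i a, j b] | a b. S a b}"
    by (rule star_mono[of _ _ 2]) (use assms(1) in \<open>auto simp: tuples_def\<close>)
  then show ?thesis
    using assms(2) by (auto simp: star_rel_def)
qed

lemma star_rel_conj:
  assumes "inj i" and "inj j" and "star_rel star i j R s t" and "star_rel star i j S s t"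
  shows "star_rel star i j (\<lambda>a b. R a b \<and> S a b) s t"
proof -
  have "{[i a, j b] | a b. R a b \<and> S a b} = {[i a, j b] | a b. R a b} \<inter> {[i a, j b] | a b. S a b}"
    using assms(1,2) by (auto dest: injD)
  moreover have "{[i a, j b] | a b. R a b} \<subseteq> tuples 2" and "{[i a, j b] | a b. S a b} \<subseteq> tuples 2"
    by (auto simp: tuples_def)
  ultimately show ?thesis
    using assms(3,4) by (simp add: star_rel_def star_Int)
qed

lemma star_rel_Times:
  "star_rel star i j (\<lambda>a b. a \<in> A \<and> b \<in> B) s t \<longleftrightarrow> s \<in> star_set star i A \<and> t \<in> star_set star j B"
proof -
  let ?A = "{[i a] | a. a \<in> A}" and ?B = "{[j b] | b. b \<in> B}"
  have arity: "?A \<subseteq> tuples 1" "?B \<subseteq> tuples 1"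
    by (auto simp: tuples_def)
  have "{[i a, j b] | a b. a \<in> A \<and> b \<in> B} = {xs @ ys | xs ys. xs \<in> ?A \<and> ys \<in> ?B}"
    by (intro equalityI subsetI; clarsimp; metis append_Cons append_Nil)
  then have *: "star {[i a, j b] | a b. a \<in> A \<and> b \<in> B}
      = {xs @ ys | xs ys. xs \<in> star ?A \<and> ys \<in> star ?B}"
    using star_product[OF arity] by simp
  have singleton: "\<exists>u. xs = [u]" if "xs \<in> star ?A" for xs
    using star_arity[OF arity(1)] that by (auto simp: tuples_def length_Suc_conv)
  have "[s, t] \<in> {xs @ ys | xs ys. xs \<in> star ?A \<and> ys \<in> star ?B}
      \<longleftrightarrow> [s] \<in> star ?A \<and> [t] \<in> star ?B"
  proof
    assume "[s, t] \<in> {xs @ ys | xs ys. xs \<in> star ?A \<and> ys \<in> star ?B}"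
    then obtain xs ys where xs: "[s, t] = xs @ ys" "xs \<in> star ?A" "ys \<in> star ?B"
      by blast
    with singleton[of xs] show "[s] \<in> star ?A \<and> [t] \<in> star ?B"
      by auto
  next
    assume "[s] \<in> star ?A \<and> [t] \<in> star ?B"
    then show "[s, t] \<in> {xs @ ys | xs ys. xs \<in> star ?A \<and> ys \<in> star ?B}"
      by (intro CollectI exI[of _ "[s]"] exI[of _ "[t]"]) simp
  qed
  then show ?thesis
    by (simp add: star_rel_def star_set_def *)
qed

text \<open>
  Conjoining \<open>R\<close> with \<open>A \<times> B\<close> and enlarging the result to \<open>A' \<times> B'\<close> turns a standard implication
  about related pairs into the same implication about nonstandard ones.
\<close>

lemma star_rel_transfer:
  assumes "inj i" and "inj j"
    and "star_rel star i j R s t" and "s \<in> star_set star i A" and "t \<in> star_set star j B"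
    and imp: "\<And>a b. R a b \<Longrightarrow> a \<in> A \<Longrightarrow> b \<in> B \<Longrightarrow> a \<in> A' \<and> b \<in> B'"
  shows "s \<in> star_set star i A'" and "t \<in> star_set star j B'"
proof -
  have "star_rel star i j (\<lambda>a b. a \<in> A \<and> b \<in> B) s t"
    using assms(4,5) by (simp add: star_rel_Times)
  from star_rel_conj[OF assms(1-3) this]
  have "star_rel star i j (\<lambda>a b. a \<in> A' \<and> b \<in> B') s t"
    by (rule star_rel_mono[rotated]) (use imp in auto)
  then show "s \<in> star_set star i A'" and "t \<in> star_set star j B'"
    by (simp_all add: star_rel_Times)
qed

lemma star_set_mono:
  assumes "A \<subseteq> B" and "s \<in> star_set star i A"
  shows "s \<in> star_set star i B"
proof -
  have "star {[i a] | a. a \<in> A} \<subseteq> star {[i a] | a. a \<in> B}"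
    by (rule star_mono[of _ _ 1]) (use assms(1) in \<open>auto simp: tuples_def\<close>)
  then show ?thesis
    using assms(2) by (auto simp: star_set_def)
qed

section \<open>Extensions of functions and points\<close>

lemma star_rel_total:
  assumes "s \<in> star_set star i A" and total: "\<And>a. a \<in> A \<Longrightarrow> \<exists>b. R a b"
  shows "\<exists>t. star_rel star i j R s t"
proof -
  let ?G = "{[i a, j b] | a b. R a b}"
  have arity: "?G \<subseteq> tuples (Suc 1)"
    by (auto simp: tuples_def)
  have "butlast ` ?G \<subseteq> tuples 1"
    by (auto simp: tuples_def)
  moreover have "{[i a] | a. a \<in> A} \<subseteq> butlast ` ?G"
  proof
    fix xs
    assume "xs \<in> {[i a] | a. a \<in> A}"
    then obtain a where "xs = [i a]" "a \<in> A"
      by blast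
    moreover from total[OF this(2)] obtain b where "R a b"
      by blast
    ultimately show "xs \<in> butlast ` ?G"
      by (intro image_eqI[of _ _ "[i a, j b]"]) auto
  qed
  ultimately have "star {[i a] | a. a \<in> A} \<subseteq> star (butlast ` ?G)"
    by (rule star_mono[rotated])
  then have "star {[i a] | a. a \<in> A} \<subseteq> butlast ` star ?G"
    by (simp only: star_projection[OF arity])
  then obtain xs where xs: "xs \<in> star ?G" "[s] = butlast xs"
    using assms(1) by (auto simp: star_set_def)
  then have "length xs = 2"
    using star_arity[OF arity] by (auto simp: tuples_def)
  with xs(2) obtain t where "xs = [s, t]"
    by (auto simp: length_Suc_conv numeral_2_eq_2)
  with xs(1) show ?thesis
    by (auto simp: star_rel_def)
qed

text \<open>
  Single-valuedness of a relation \<open>G\<close> is the inclusion of \<open>(G \<times> G) \<inter> {x\<^sub>0 = x\<^sub>2}\<close> in \<open>{x\<^sub>1 = x\<^sub>3}\<close>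
  between sets of quadruples, and every set in it has an extension that the axioms determine from
  the extension of \<open>G\<close>.
\<close>

lemma star_rel_single_valued:
  assumes "inj i" and sv: "\<And>a b b'. R a b \<Longrightarrow> R a b' \<Longrightarrow> b = b'"
    and "star_rel star i j R s t" and "star_rel star i j R s t'"
  shows "t = t'"
proof -
  let ?G = "{[i a, j b] | a b. R a b}"
  let ?P = "{xs @ ys | xs ys. xs \<in> ?G \<and> ys \<in> ?G}"
  let ?D = "{xs \<in> tuples 4. xs ! 0 = xs ! 2}"
  let ?D' = "{xs \<in> tuples 4. xs ! 1 = xs ! 3}"
  have arity: "?G \<subseteq> tuples 2" "?P \<subseteq> tuples 4"
    by (auto simp: tuples_def)
  have "[s, t, s, t'] \<in> {xs @ ys | xs ys. xs \<in> star ?G \<and> ys \<in> star ?G}"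
    using assms(3,4) unfolding star_rel_def
    by (intro CollectI exI[of _ "[s, t]"] exI[of _ "[s, t']"]) simp
  then have "[s, t, s, t'] \<in> star ?P"
    using star_product[OF arity(1) arity(1)] by simp
  moreover have "[s, t, s, t'] \<in> star ?D"
    by (subst star_diagonal) (auto simp: tuples_def)
  ultimately have "[s, t, s, t'] \<in> star (?P \<inter> ?D)"
    using star_Int[OF arity(2), of ?D] by auto
  moreover have "?P \<inter> ?D \<subseteq> ?D'"
  proof
    fix zs
    assume zs: "zs \<in> ?P \<inter> ?D"
    then obtain xs ys where "zs = xs @ ys" "xs \<in> ?G" "ys \<in> ?G"
      by blast
    then obtain a b a' b' where ab: "zs = [i a, j b, i a', j b']" "R a b" "R a' b'"
      by auto
    with zs have "a = a'"
      using injD[OF assms(1)] by simp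
    with ab have "b = b'"
      using sv by blast
    with ab show "zs \<in> ?D'"
      by (simp add: tuples_def numeral_3_eq_3)
  qed
  then have "star (?P \<inter> ?D) \<subseteq> star ?D'"
    by (rule star_mono) auto
  moreover have "star ?D' = {xs \<in> tuples 4. xs ! 1 = xs ! 3}"
    by (rule star_diagonal) auto
  ultimately show ?thesis
    by (auto simp: numeral_3_eq_3)
qed

lemma star_fun_graph:
  assumes "inj i" and "s \<in> star_set star i A"
  shows "star_rel star i j (\<lambda>a b. a \<in> A \<and> b = f a) s (star_fun star i j A f s)"
proof -
  let ?R = "\<lambda>a b. a \<in> A \<and> b = f a"
  have graph: "{[i a, j (f a)] | a. a \<in> A} = {[i a, j b] | a b. ?R a b}"
    by auto
  have "\<exists>t. star_rel star i j ?R s t"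
    by (rule star_rel_total[OF assms(2)]) auto
  moreover have "t = t'" if "star_rel star i j ?R s t" "star_rel star i j ?R s t'" for t t'
    by (rule star_rel_single_valued[OF assms(1) _ that]) auto
  ultimately have "\<exists>!t. star_rel star i j ?R s t"
    by (rule ex_ex1I)
  then have "star_rel star i j ?R s (THE t. star_rel star i j ?R s t)"
    by (rule theI')
  moreover have "star_fun star i j A f s = (THE t. star_rel star i j ?R s t)"
    unfolding star_fun_def star_rel_def by (simp only: graph)
  ultimately show ?thesis
    by (simp only:)
qed

lemma star_fun_range:
  assumes "inj i" and "s \<in> star_set star i A"
  shows "star_fun star i j A f s \<in> star_set star j (f ` A)"
proof -
  have "star_rel star i j (\<lambda>a b. a \<in> A \<and> b \<in> f ` A) s (star_fun star i j A f s)"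
    using star_fun_graph[OF assms] by (rule star_rel_mono[rotated]) auto
  then show ?thesis
    by (simp add: star_rel_Times)
qed

lemma star_fun_image:
  assumes "inj i" and "inj j" and "s \<in> star_set star i A" and "s \<in> star_set star i A'"
    and "\<And>a. a \<in> A \<Longrightarrow> a \<in> A' \<Longrightarrow> f a \<in> B"
  shows "star_fun star i j A f s \<in> star_set star j B"
proof -
  have graph: "star_rel star i j (\<lambda>a b. a \<in> A \<and> b = f a) s (star_fun star i j A f s)"
    using assms(1,3) by (rule star_fun_graph)
  have range: "star_fun star i j A f s \<in> star_set star j (f ` A)"
    using assms(1,3) by (rule star_fun_range)
  show ?thesis
    by (rule star_rel_transfer(2)[OF assms(1,2) graph assms(4) range, where A' = A'])
      (use assms(5) in auto)
qed

lemma star_fun_vimage: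
  assumes "inj i" and "inj j" and "s \<in> star_set star i A"
    and "star_fun star i j A f s \<in> star_set star j B"
  shows "s \<in> star_set star i {a \<in> A. f a \<in> B}"
proof -
  have "star_rel star i j (\<lambda>a b. a \<in> A \<and> b = f a) s (star_fun star i j A f s)"
    using assms(1,3) by (rule star_fun_graph)
  from star_rel_transfer(1)[OF assms(1,2) this assms(3,4), where B' = B] show ?thesis
    by simp
qed

text \<open>
  The extension of a singleton is inhabited because its projection to \<open>tuples 0\<close> is: \<open>{[]}\<close>, being
  the projection of \<open>tuples 1\<close>, extends to itself.  It has at most one element because the square
  of a singleton is contained in the diagonal.
\<close>

lemma star_of_mem: "star_of star i a \<in> star_set star i {a}"
proof -
  have arity: "{[i a]} \<subseteq> tuples 1" "{[i a]} \<subseteq> tuples (Suc 0)"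
    by (auto simp: tuples_def)
  have "star {[]} = butlast ` star (tuples (Suc 0))"
    using star_projection[of "tuples (Suc 0)" 0] by (simp add: butlast_tuples_Suc_0)
  also have "\<dots> = {[]}"
    using star_universe by (simp add: butlast_tuples_Suc_0)
  finally have "butlast ` star {[i a]} = {[]}"
    using star_projection[OF arity(2)] by simp
  then obtain xs where xs: "xs \<in> star {[i a]}"
    by blast
  then have "length xs = 1"
    using star_arity[OF arity(1)] by (auto simp: tuples_def)
  with xs obtain s where s: "[s] \<in> star {[i a]}"
    by (auto simp: length_Suc_conv)
  have "t = t'" if "[t] \<in> star {[i a]}" "[t'] \<in> star {[i a]}" for t t'
  proof -
    have "star_rel star i i (\<lambda>b c. b \<in> {a} \<and> c \<in> {a}) t t'"
      using that by (subst star_rel_Times) (simp add: star_set_def)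
    then have "[t, t'] \<in> star {[i a, i a]}"
      by (simp add: star_rel_def)
    moreover have "star {[i a, i a]} \<subseteq> star {xs \<in> tuples 2. xs ! 0 = xs ! 1}"
      by (rule star_mono) (auto simp: tuples_def)
    moreover have "star {xs \<in> tuples 2. xs ! 0 = xs ! 1} = {xs \<in> tuples 2. xs ! 0 = xs ! 1}"
      by (rule star_diagonal) auto
    ultimately show ?thesis
      by auto
  qed
  with s have "\<exists>!s. [s] \<in> star {[i a]}"
    by blast
  from theI'[OF this] show ?thesis
    by (simp add: star_of_def star_set_def)
qed

section \<open>Finite hyperreals\<close>

text \<open>
  Finiteness is a condition on standard sets: the extended absolute value and order can be absorbed
  into membership in the extension of an interval.
\<close>

lemma finite_hyperreal_iff:
  assumes "inj r"
  shows "finite_hyperreal star r s \<longleftrightarrow> (\<exists>n::nat. s \<in> star_set star r {x. \<bar>x\<bar> \<le> real n})"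
proof
  assume "finite_hyperreal star r s"
  then obtain n :: nat where s: "s \<in> star_set star r UNIV"
    and n: "star_rel star r r (\<le>) (star_fun star r r UNIV abs s) (star_of star r (real n))"
    by (auto simp: finite_hyperreal_def)
  have "star_fun star r r UNIV abs s \<in> star_set star r UNIV"
    using star_fun_image[OF assms assms s s, of abs UNIV] by simp
  from star_rel_transfer(1)[OF assms assms n this star_of_mem, of "{..real n}" UNIV]
  have "star_fun star r r UNIV abs s \<in> star_set star r {..real n}"
    by auto
  from star_fun_vimage[OF assms assms s this]
  show "\<exists>n::nat. s \<in> star_set star r {x. \<bar>x\<bar> \<le> real n}"
    by auto
next
  assume "\<exists>n::nat. s \<in> star_set star r {x. \<bar>x\<bar> \<le> real n}"
  then obtain n :: nat where n: "s \<in> star_set star r {x. \<bar>x\<bar> \<le> real n}"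
    by blast
  have s: "s \<in> star_set star r UNIV"
    by (rule star_set_mono[OF _ n]) simp
  have "star_fun star r r UNIV abs s \<in> star_set star r {..real n}"
    by (rule star_fun_image[OF assms assms s n]) auto
  then have "star_rel star r r (\<lambda>x y. x \<in> {..real n} \<and> y \<in> {real n})
      (star_fun star r r UNIV abs s) (star_of star r (real n))"
    using star_of_mem by (subst star_rel_Times) simp
  then have "star_rel star r r (\<le>) (star_fun star r r UNIV abs s) (star_of star r (real n))"
    by (rule star_rel_mono[rotated]) auto
  with s show "finite_hyperreal star r s"
    by (auto simp: finite_hyperreal_def)
qed

lemma finite_hyperreal_star_fun_iff:
  assumes "inj r" and "inj i" and s: "s \<in> star_set star i A"
  shows "finite_hyperreal star r (star_fun star i r A p s) \<longleftrightarrow>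
    (\<exists>n::nat. s \<in> star_set star i {a \<in> A. \<bar>p a\<bar> \<le> real n})"
proof -
  have "star_fun star i r A p s \<in> star_set star r {x. \<bar>x\<bar> \<le> real n} \<longleftrightarrow>
      s \<in> star_set star i {a \<in> A. \<bar>p a\<bar> \<le> real n}" for n :: nat
    using star_fun_vimage[OF assms(2,1) s, of p "{x. \<bar>x\<bar> \<le> real n}"]
      star_fun_image[OF assms(2,1) s, of "{a \<in> A. \<bar>p a\<bar> \<le> real n}" p "{x. \<bar>x\<bar> \<le> real n}"]
    by auto
  then show ?thesis
    by (simp add: finite_hyperreal_iff[OF assms(1)])
qed

end

section \<open>Lipschitz functions\<close>

lemma lipschitz_lcs_affine_bound:
  assumes "lipschitz_lcs U f" and "0 \<in> U" and q: "continuous_seminorm q"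
  obtains p where "continuous_seminorm p" and "\<And>x. x \<in> U \<Longrightarrow> q (f x) \<le> p x + q (f 0)"
proof -
  obtain p where p: "continuous_seminorm p"
    and bound: "\<And>x1 x2. x1 \<in> U \<Longrightarrow> x2 \<in> U \<Longrightarrow> q (f x1 - f x2) \<le> p (x1 - x2)"
    using assms(1) q unfolding lipschitz_lcs_def by blast
  have "q (f x) \<le> p x + q (f 0)" if "x \<in> U" for x
  proof -
    have "q (f x - f 0 + f 0) \<le> q (f x - f 0) + q (f 0)"
      using q unfolding continuous_seminorm_def by blast
    then show ?thesis
      using bound[OF that assms(2)] by simp
  qed
  with p show ?thesis
    by (rule that)
qed

theorem lemma4p6:
  fixes star :: "'u list set \<Rightarrow> 's list set"
    and \<kappa> :: "'k rel"
    and r :: "real \<Rightarrow> 'u"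
    and i :: "'e::locally_convex_space \<Rightarrow> 'u"
    and j :: "'f::locally_convex_space \<Rightarrow> 'u"
    and U :: "'e set"
    and f :: "'e \<Rightarrow> 'f"
  assumes "inj r" and "inj i" and "inj j"
    and "nonstandard_extension star"
    and "Card_order \<kappa>"
    and "(natLeq, \<kappa>) \<in> ordLess"
    and "(card_of {p :: 'e \<Rightarrow> real. continuous_seminorm p}, \<kappa>) \<in> ordLess"
    and "(card_of {q :: 'f \<Rightarrow> real. continuous_seminorm q}, \<kappa>) \<in> ordLess"
    and "saturated star \<kappa>"
    and "open U" and "0 \<in> U"
    and "lipschitz_lcs U f"
  shows "finite_function star r i j U f"
proof -
  interpret nonstandard_extension star
    by fact
  have "star_fun star i j U f s \<in> finite_points star r j"
    if sU: "s \<in> star_set star i U" and sfin: "s \<in> finite_points star r i" for s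
  proof -
    let ?t = "star_fun star i j U f s"
    have s: "s \<in> star_set star i UNIV"
      using sfin by (simp add: finite_points_def)
    have t: "?t \<in> star_set star j UNIV"
      by (rule star_fun_image[OF \<open>inj i\<close> \<open>inj j\<close> sU sU]) simp
    have "finite_hyperreal star r (star_fun star j r UNIV q ?t)" if q: "continuous_seminorm q" for q
    proof -
      obtain p where p: "continuous_seminorm p"
        and bound: "\<And>x. x \<in> U \<Longrightarrow> q (f x) \<le> p x + q (f 0)"
        using lipschitz_lcs_affine_bound[OF \<open>lipschitz_lcs U f\<close> \<open>0 \<in> U\<close> q] by blast
      have "finite_hyperreal star r (star_fun star i r UNIV p s)"
        using sfin p by (simp add: finite_points_def)
      then obtain n :: nat where n: "s \<in> star_set star i {x \<in> UNIV. \<bar>p x\<bar> \<le> real n}"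
        unfolding finite_hyperreal_star_fun_iff[OF \<open>inj r\<close> \<open>inj i\<close> s] by blast
      obtain k :: nat where k: "q (f 0) \<le> real k"
        using real_arch_simple by blast
      have q_nonneg: "0 \<le> q y" for y
        using q by (simp add: continuous_seminorm_def)
      have "\<bar>q (f x)\<bar> \<le> real (n + k)" if "x \<in> U" "\<bar>p x\<bar> \<le> real n" for x
        using bound[OF that(1)] that(2) k q_nonneg[of "f x"] by simp
      then have "?t \<in> star_set star j {y \<in> UNIV. \<bar>q y\<bar> \<le> real (n + k)}"
        by (intro star_fun_image[OF \<open>inj i\<close> \<open>inj j\<close> sU n]) auto
      then show ?thesis
        unfolding finite_hyperreal_star_fun_iff[OF \<open>inj r\<close> \<open>inj j\<close> t] by blast
    qed
    with t show ?thesis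
      by (simp add: finite_points_def)
  qed
  then show ?thesis
    by (auto simp: finite_function_def)
qed

end
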